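(* For each positive integer $n$, let $P_n$ denote the set of even trigonometric polynomials $f_n(\varphi) = \sum_{k=0}^n a_k \cos(k\varphi)$ with real coefficients such that $a_k \geq 0$ for each $0 \leq k \leq n$, $a_1 > a_0$, and $f_n(\varphi) \geq 0$ for all real $\varphi$. Let \[ V = \lim_{n\to\infty} \inf_{f_n\in P_n} \frac{f_n(0)-a_0}{(\sqrt{a_1}-\sqrt{a_0})^2}, \] where $a_0, a_1$ denote the coefficients of $f_n$ in the expansion $f_n(\varphi) = \sum_{k=0}^n a_k \cos(k\varphi)$, that is, $a_0$ is the constant term and $a_1$ is the coefficient of $\cos\varphi$. Then \[ 34.468305 < V < 34.4889920009. \]
   Context: Polynomials in $P_n$ are those expressible as $\sum_{k=0}^n a_k\cos(k\varphi)$ with the stated properties; $f_n(0)-a_0 = \sum_{k=1}^n a_k$. The infimum over $P_n$ is non-increasing in $n$ (with the convention that the infimum of the empty set is $+\infty$), so the limit defining $V$ exists. The decimal constants are exact. *)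

theory Defs
  imports "HOL-Analysis.Analysis"
begin

definition cos_poly :: "nat \<Rightarrow> (nat \<Rightarrow> real) \<Rightarrow> real \<Rightarrow> real" where
  "cos_poly n a \<phi> = (\<Sum>k\<le>n. a k * cos (real k * \<phi>))"

text \<open>
  An even trigonometric polynomial is represented by its (uniquely determined) coefficient
  sequence, padded with zeros beyond index \<open>n\<close>.
\<close>

definition P :: "nat \<Rightarrow> (nat \<Rightarrow> real) set" where
  "P n = {a. (\<forall>k>n. a k = 0) \<and> (\<forall>k\<le>n. a k \<ge> 0) \<and> a 1 > a 0 \<and>
             (\<forall>\<phi>. cos_poly n a \<phi> \<ge> 0)}"

definition ratio :: "nat \<Rightarrow> (nat \<Rightarrow> real) \<Rightarrow> real" where
  "ratio n a = (cos_poly n a 0 - a 0) / (sqrt (a 1) - sqrt (a 0))\<^sup>2"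

text \<open>
  The infimum is taken in the extended reals because \<open>P n\<close> is empty for small \<open>n\<close>;
  the infimum is then \<open>\<infinity>\<close>.
\<close>

definition inf_ratio :: "nat \<Rightarrow> ereal" where
  "inf_ratio n = (INF a\<in>P n. ereal (ratio n a))"

definition V :: ereal where
  "V = lim inf_ratio"

lemma cos_poly_Suc:
  assumes "a \<in> P n"
  shows "cos_poly (Suc n) a = cos_poly n a"
  using assms by (auto simp: P_def cos_poly_def fun_eq_iff)

lemma P_mono: "P n \<subseteq> P (Suc n)"
proof
  fix a assume a: "a \<in> P n"
  have "a k \<ge> 0" for k
    using a by (cases "k \<le> n") (auto simp: P_def)
  moreover have "\<forall>\<phi>. cos_poly (Suc n) a \<phi> \<ge> 0"
    using a cos_poly_Suc[OF a] by (simp add: P_def)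
  ultimately show "a \<in> P (Suc n)"
    using a by (auto simp: P_def)
qed

lemma decseq_inf_ratio: "decseq inf_ratio"
proof (rule decseq_SucI)
  fix n
  show "inf_ratio (Suc n) \<le> inf_ratio n"
    unfolding inf_ratio_def
  proof (rule INF_mono)
    fix a assume a: "a \<in> P n"
    have "ereal (ratio (Suc n) a) \<le> ereal (ratio n a)"
      by (simp add: ratio_def cos_poly_Suc[OF a])
    then show "\<exists>b\<in>P (Suc n). ereal (ratio (Suc n) b) \<le> ereal (ratio n a)"
      using a P_mono by blast
  qed
qed

lemma inf_ratio_tendsto_V: "inf_ratio \<longlonglongrightarrow> V"
  unfolding V_def using LIMSEQ_INF[OF decseq_inf_ratio] limI by metis

end

theory Submission
  imports Defs
begin

text \<open>
  Both inequalities rest on one elementary source of nonnegative even trigonometric polynomials: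
  for a real list \<open>h\<close> the function \<open>\<bar>\<Sum>\<^sub>j h\<^sub>j exp (\<i> j \<phi>)\<bar>\<^sup>2\<close> is the cosine polynomial whose
  coefficients are the autocorrelations \<open>r\<^sub>k = \<Sum>\<^sub>j h\<^sub>j h\<^sub>j\<^sub>+\<^sub>k\<close>, doubled for \<open>k \<ge> 1\<close>
  (lemma \<open>cos_poly_square_coeffs\<close>).

  For the upper bound one such square is exhibited. By \<open>decseq_inf_ratio\<close> its ratio bounds the limit
  from above, and since the value at \<open>0\<close> is just the square of the entry sum, the
  ratio is computed from a handful of integers (lemma \<open>ratio_near_optimal\<close>).

  The lower bound is linear programming duality. The mean over a period of the product of some
  \<open>a \<in> P n\<close> with a square is nonnegative, which says \<open>\<Sum>\<^sub>k a\<^sub>k r\<^sub>k \<ge> 0\<close>. If \<open>r\<^sub>k \<le> D\<close> for all \<open>k \<ge> 2\<close>,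
  then, the \<open>a\<^sub>k\<close> being nonnegative, \<open>D (a\<^sub>1 + a\<^sub>2 + \<dots>) \<ge> (D - r\<^sub>1) a\<^sub>1 - r\<^sub>0 a\<^sub>0\<close> (lemma \<open>P_coeff_sum_ge\<close>).
  The condition on \<open>r\<close> concerns finitely many \<open>k\<close> because \<open>r\<close> vanishes from the length of \<open>h\<close> on,
  and the resulting inequality holds for every \<open>n\<close>; this is how the infinitely many problems are
  bounded at once.

  The quantity to be bounded below is not linear, but \<open>(\<surd>a\<^sub>1 - \<surd>a\<^sub>0)\<^sup>2\<close> is convex
  in \<open>a\<^sub>1\<close> for fixed \<open>a\<^sub>0\<close>. Hence a linear minorant of the coefficient sum dominates a multiple of it on
  a whole interval of values of \<open>\<surd>a\<^sub>1 / \<surd>a\<^sub>0\<close> as soon as it does so at both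
  ends (lemma \<open>P_coeff_sum_ge_between\<close>). This quotient lies between \<open>1\<close> and \<open>\<surd>2\<close>, the upper limit being
  again an instance of duality, with the square \<open>\<bar>1 - exp (\<i> \<phi>)\<bar>\<^sup>2\<close>. The range is covered by four
  intervals: on the first
  the trivial bound by \<open>a\<^sub>1\<close> suffices, on the others three explicit lists do the work. These, and the
  list for the upper bound, are rounded spectral factors of numerically computed
  nearly optimal solutions of the corresponding linear programs.
\<close>

section \<open>Squared moduli as cosine polynomials\<close>

definition autocorr :: "'a::comm_ring_1 list \<Rightarrow> nat \<Rightarrow> 'a" where
  "autocorr h k = sum_list (map2 (*) h (drop k h))"

definition square_coeffs :: "real list \<Rightarrow> nat \<Rightarrow> real" where
  "square_coeffs h k = (if k = 0 then autocorr h 0 else 2 * autocorr h k)"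

lemma autocorr_Nil [simp]: "autocorr [] k = 0"
  by (simp add: autocorr_def)

text \<open>
  Prepending \<open>x\<close> adds exactly the products that involve \<open>x\<close>, one for each lag. This recursion
  drives the induction in \<open>cos_poly_square_coeffs\<close>.
\<close>

lemma autocorr_Cons:
  "autocorr (x # xs) k = (if k \<le> length xs then x * (x # xs) ! k else 0) + autocorr xs k"
proof (cases "k \<le> length xs")
  case True
  then have "drop k (x # xs) = (x # xs) ! k # drop k xs"
    using Cons_nth_drop_Suc[of k "x # xs"] by simp
  then show ?thesis
    using True by (simp add: autocorr_def)
qed (simp add: autocorr_def)

lemma autocorr_beyond: "length h \<le> k \<Longrightarrow> autocorr h k = 0"
  by (simp add: autocorr_def)

text \<open>
  Write \<open>C + \<i> S\<close> for the exponential sum of \<open>xs\<close>. Prepending \<open>x\<close> turns it into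
  \<open>x + exp (\<i> \<phi>) (C + \<i> S)\<close>, whose squared modulus exceeds \<open>C\<^sup>2 + S\<^sup>2\<close> by \<open>x\<^sup>2\<close> and twice \<open>x\<close> times the
  real part of \<open>exp (\<i> \<phi>) (C + \<i> S)\<close>; these are the terms that \<open>autocorr_Cons\<close> contributes.
\<close>

lemma cos_poly_square_coeffs:
  assumes "length h \<le> Suc n"
  shows "cos_poly n (square_coeffs h) \<phi> =
    (\<Sum>i<length h. h ! i * cos (real i * \<phi>))\<^sup>2 + (\<Sum>i<length h. h ! i * sin (real i * \<phi>))\<^sup>2"
  using assms
proof (induction h)
  case Nil
  then show ?case by (auto simp: cos_poly_def square_coeffs_def intro!: sum.neutral)
next
  case (Cons x xs)
  let ?N = "length xs"
  define C where "C = (\<Sum>i<?N. xs ! i * cos (real i * \<phi>))"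
  define S where "S = (\<Sum>i<?N. xs ! i * sin (real i * \<phi>))"
  define e where "e k = (if k = 0 then x\<^sup>2 else if k \<le> ?N then 2 * x * xs ! (k - 1) else 0)" for k
  have coeffs: "square_coeffs (x # xs) k = square_coeffs xs k + e k" for k
    by (cases k) (auto simp: square_coeffs_def autocorr_Cons e_def power2_eq_square)
  have N: "?N \<le> n" using Cons.prems by simp
  have "(\<Sum>k\<le>n. e k * cos (real k * \<phi>)) = (\<Sum>k\<le>?N. e k * cos (real k * \<phi>))"
    using N by (intro sum.mono_neutral_right) (auto simp: e_def)
  also have "\<dots> = x\<^sup>2 + 2 * x * (\<Sum>i<?N. xs ! i * cos (real (Suc i) * \<phi>))"
    by (auto simp: sum.atMost_shift e_def sum_distrib_left mult_ac intro!: sum.cong)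
  also have "(\<Sum>i<?N. xs ! i * cos (real (Suc i) * \<phi>)) = C * cos \<phi> - S * sin \<phi>"
    by (simp add: C_def S_def sum_distrib_left cos_add ring_distribs sum_subtractf mult_ac)
  finally have e_sum: "(\<Sum>k\<le>n. e k * cos (real k * \<phi>)) = x\<^sup>2 + 2 * x * (C * cos \<phi> - S * sin \<phi>)" .
  have "cos_poly n (square_coeffs (x # xs)) \<phi> = C\<^sup>2 + S\<^sup>2 + (\<Sum>k\<le>n. e k * cos (real k * \<phi>))"
    using Cons.IH Cons.prems
    by (simp add: cos_poly_def coeffs ring_distribs sum.distrib C_def S_def)
  also have "\<dots> = (x + (C * cos \<phi> - S * sin \<phi>))\<^sup>2 + (C * sin \<phi> + S * cos \<phi>)\<^sup>2"
  proof -
    have "(x + (C * c - S * s))\<^sup>2 + (C * s + S * c)\<^sup>2 =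
        x\<^sup>2 + 2 * x * (C * c - S * s) + (C\<^sup>2 + S\<^sup>2) * (c\<^sup>2 + s\<^sup>2)" for c s
      by (simp add: power2_eq_square algebra_simps)
    then show ?thesis unfolding e_sum by simp
  qed
  also have "C * cos \<phi> - S * sin \<phi> = (\<Sum>i<?N. xs ! i * cos (real (Suc i) * \<phi>))"
    by (simp add: C_def S_def sum_distrib_left cos_add ring_distribs sum_subtractf mult_ac)
  also have "C * sin \<phi> + S * cos \<phi> = (\<Sum>i<?N. xs ! i * sin (real (Suc i) * \<phi>))"
    by (simp add: C_def S_def sum_distrib_left sin_add ring_distribs sum.distrib mult_ac add_ac)
  finally show ?case
    by (simp add: sum.lessThan_Suc_shift del: sum.lessThan_Suc of_nat_Suc)
qed

lemma cos_poly_square_coeffs_nonneg: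
  "length h \<le> Suc n \<Longrightarrow> cos_poly n (square_coeffs h) \<phi> \<ge> 0"
  by (simp add: cos_poly_square_coeffs)

lemma cos_poly_square_coeffs_0:
  "length h \<le> Suc n \<Longrightarrow> cos_poly n (square_coeffs h) 0 = (sum_list h)\<^sup>2"
  by (simp add: cos_poly_square_coeffs sum_list_sum_nth atLeast0LessThan)

section \<open>Positivity of the pairing\<close>

lemma cos_int_mult_has_integral:
  fixes m :: int
  shows "((\<lambda>\<phi>. cos (of_int m * \<phi>)) has_integral (if m = 0 then 2 * pi else 0)) {0..2 * pi}"
proof (cases "m = 0")
  case True
  then show ?thesis using has_integral_const_real[of "1::real" 0 "2 * pi"] by simp
next
  case False
  have "((\<lambda>\<phi>. cos (of_int m * \<phi>)) has_integral
      (sin (of_int m * (2 * pi)) / of_int m - sin (of_int m * 0) / of_int m)) {0..2 * pi}"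
    using False
    by (intro fundamental_theorem_of_calculus)
       (auto simp: has_real_derivative_iff_has_vector_derivative[symmetric]
             intro!: derivative_eq_intros)
  moreover have "sin (of_int m * (2 * pi)) = 0"
    using sin_zero_iff_int2 by (metis mult.assoc of_int_mult of_int_numeral)
  ultimately show ?thesis using False by simp
qed

lemma cos_cos_has_integral:
  fixes j k :: nat
  shows "((\<lambda>\<phi>. cos (real j * \<phi>) * cos (real k * \<phi>)) has_integral
    (if j = k then if k = 0 then 2 * pi else pi else 0)) {0..2 * pi}"
proof -
  have "((\<lambda>\<phi>. (cos (of_int (int j - int k) * \<phi>) + cos (of_int (int j + int k) * \<phi>)) / 2)
      has_integral ((if int j - int k = 0 then 2 * pi else 0) +
        (if int j + int k = 0 then 2 * pi else 0)) / 2) {0..2 * pi}"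
    by (intro has_integral_divide has_integral_add cos_int_mult_has_integral)
  moreover have "(cos (of_int (int j - int k) * \<phi>) + cos (of_int (int j + int k) * \<phi>)) / 2 =
      cos (real j * \<phi>) * cos (real k * \<phi>)" for \<phi>
    by (simp add: cos_times_cos algebra_simps)
  moreover have "((if int j - int k = 0 then 2 * pi else 0) + (if int j + int k = 0 then 2 * pi else 0)) / 2 =
      (if j = k then if k = 0 then 2 * pi else pi else 0)"
    by simp
  ultimately show ?thesis
    by (simp only:)
qed

text \<open>
  The product of two nonnegative functions has nonnegative integral over a period, and orthogonality of
  the cosines evaluates this integral as \<open>\<pi>\<close> times the expression below. The factor 2 at
  index 0 reflects that the constant function has twice the squared norm of the other cosines.
\<close>

lemma cos_poly_pairing_nonneg:
  assumes "\<And>\<phi>. cos_poly n a \<phi> \<ge> 0" "\<And>\<phi>. cos_poly n b \<phi> \<ge> 0"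
  shows "2 * a 0 * b 0 + (\<Sum>k=1..n. a k * b k) \<ge> 0"
proof -
  define I where "I j k = (if j = k then if k = 0 then 2 * pi else pi else 0)" for j k :: nat
  have prod: "cos_poly n a \<phi> * cos_poly n b \<phi> =
      (\<Sum>j\<le>n. \<Sum>k\<le>n. a j * b k * (cos (real j * \<phi>) * cos (real k * \<phi>)))" for \<phi>
    unfolding cos_poly_def sum_product by (intro sum.cong refl) (simp add: mult_ac)
  have "((\<lambda>\<phi>. cos_poly n a \<phi> * cos_poly n b \<phi>) has_integral
      (\<Sum>j\<le>n. \<Sum>k\<le>n. a j * b k * I j k)) {0..2 * pi}"
    unfolding prod I_def
    by (intro has_integral_sum has_integral_mult_right cos_cos_has_integral) auto
  then have "0 \<le> (\<Sum>j\<le>n. \<Sum>k\<le>n. a j * b k * I j k)"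
    by (rule has_integral_nonneg) (simp add: assms)
  also have "\<dots> = (\<Sum>j\<le>n. a j * b j * I j j)"
    by (intro sum.cong refl) (simp add: I_def if_distrib[of "\<lambda>t. _ * t"] sum.delta' cong: if_cong)
  also have "\<dots> = a 0 * b 0 * (2 * pi) + (\<Sum>j=1..n. a j * b j * pi)"
    by (simp add: I_def atMost_atLeast0 sum.atLeast_Suc_atMost)
  also have "\<dots> = pi * (2 * a 0 * b 0 + (\<Sum>k=1..n. a k * b k))"
    by (simp add: algebra_simps sum_distrib_left)
  finally show ?thesis
    using pi_gt_zero by (simp only: zero_le_mult_iff) linarith
qed

section \<open>Lower bounds from squares\<close>

lemma P_mono_add: "P n \<subseteq> P (n + m)"
  by (rule lift_Suc_mono_le[of P]) (auto simp: P_mono)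

lemma cos_poly_0_split: "cos_poly n a 0 - a 0 = (\<Sum>k=1..n. a k)"
  by (simp add: cos_poly_def atMost_atLeast0 sum.atLeast_Suc_atMost)

lemma cos_poly_0_extend: "a \<in> P n \<Longrightarrow> cos_poly (n + m) a 0 = cos_poly n a 0"
  unfolding cos_poly_def by (intro sum.mono_neutral_right) (auto simp: P_def)

text \<open>
  The doubling in \<open>square_coeffs\<close> matches the extra factor 2 at index 0 of the pairing, so that in
  terms of autocorrelations all indices have equal weight.
\<close>

lemma P_pairing_nonneg:
  assumes "a \<in> P n" "length h \<le> Suc n"
  shows "a 0 * autocorr h 0 + (\<Sum>k=1..n. a k * autocorr h k) \<ge> 0"
proof -
  have "2 * a 0 * square_coeffs h 0 + (\<Sum>k=1..n. a k * square_coeffs h k) \<ge> 0"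
    using assms by (intro cos_poly_pairing_nonneg cos_poly_square_coeffs_nonneg) (auto simp: P_def)
  also have "(\<Sum>k=1..n. a k * square_coeffs h k) = 2 * (\<Sum>k=1..n. a k * autocorr h k)"
    unfolding sum_distrib_left by (intro sum.cong) (auto simp: square_coeffs_def)
  finally show ?thesis by (simp add: square_coeffs_def)
qed

text \<open>
  Weak duality: in the pairing with the square of \<open>h\<close>, replace every autocorrelation at lag at least 2
  by its upper bound \<open>D\<close>, which only increases the sum.
\<close>

lemma P_coeff_sum_ge:
  assumes a: "a \<in> P n" and corr: "\<And>k. 2 \<le> k \<Longrightarrow> k < length h \<Longrightarrow> autocorr h k \<le> D" and D: "D \<ge> 0"
  shows "(D - autocorr h 1) * a 1 - autocorr h 0 * a 0 \<le> D * (cos_poly n a 0 - a 0)"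
proof -
  \<comment> \<open>The degree is raised so that it is at least 1 and also accommodates the square of \<open>h\<close>.\<close>
  define N where "N = n + Suc (length h)"
  have aN: "a \<in> P N" using a P_mono_add unfolding N_def by blast
  have split_1: "(\<Sum>k=1..N. f k) = f 1 + (\<Sum>k=2..N. f k)" for f :: "nat \<Rightarrow> real"
    using sum.atLeast_Suc_atMost[of 1 N f] by (simp add: N_def numeral_2_eq_2)
  have nonneg: "a k \<ge> 0" for k
    using a by (cases "k \<le> n") (auto simp: P_def)
  have "0 \<le> a 0 * autocorr h 0 + (\<Sum>k=1..N. a k * autocorr h k)"
    using aN by (rule P_pairing_nonneg) (simp add: N_def)
  also have "(\<Sum>k=1..N. a k * autocorr h k) = a 1 * autocorr h 1 + (\<Sum>k=2..N. a k * autocorr h k)"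
    by (rule split_1)
  also have "(\<Sum>k=2..N. a k * autocorr h k) \<le> (\<Sum>k=2..N. a k * D)"
  proof (intro sum_mono mult_left_mono nonneg)
    fix k assume "k \<in> {2..N}"
    then show "autocorr h k \<le> D"
      using corr[of k] D autocorr_beyond[of h k] by (cases "k < length h") auto
  qed
  also have "(\<Sum>k=2..N. a k * D) = D * (cos_poly N a 0 - a 0) - D * a 1"
    by (simp only: cos_poly_0_split split_1) (simp add: sum_distrib_left algebra_simps)
  also have "cos_poly N a 0 = cos_poly n a 0"
    unfolding N_def by (rule cos_poly_0_extend[OF a])
  finally show ?thesis by (simp add: algebra_simps)
qed

text \<open>The multiplier \<open>\<bar>1 - exp (\<i> \<phi>)\<bar>\<^sup>2\<close> has no lags beyond 1, so \<open>D = 0\<close> is admissible.\<close>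

lemma P_coeff_1_le:
  assumes "a \<in> P n"
  shows "a 1 \<le> 2 * a 0"
  using P_coeff_sum_ge[OF assms, of "[1, -1]" 0] by (simp add: autocorr_def)

text \<open>
  With \<open>x = q / p\<close> the claim compares \<open>v (x - 1)\<^sup>2\<close> with \<open>X x\<^sup>2 - m\<close>. For \<open>X \<le> v\<close> the difference is a
  concave quadratic in \<open>x\<close>, so it is nonnegative between \<open>l\<close> and \<open>u\<close> if it is so at both ends. The
  identity in the proof is the homogeneous form of this: a chord plus a
  nonnegative multiple of \<open>(x - l) (u - x)\<close>.
\<close>

lemma quadratic_ge_between:
  fixes p q X m v l u :: real
  assumes "X \<le> v" "l < u" "0 \<le> p" "l * p \<le> q" "q \<le> u * p"
    and l: "v * (l - 1)\<^sup>2 \<le> X * l\<^sup>2 - m" and u: "v * (u - 1)\<^sup>2 \<le> X * u\<^sup>2 - m"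
  shows "v * (q - p)\<^sup>2 \<le> X * q\<^sup>2 - m * p\<^sup>2"
proof -
  have "(u - l) * (X * q\<^sup>2 - m * p\<^sup>2 - v * (q - p)\<^sup>2) =
      (u * p - q) * p * (X * l\<^sup>2 - m - v * (l - 1)\<^sup>2) + (q - l * p) * p * (X * u\<^sup>2 - m - v * (u - 1)\<^sup>2) +
      (u - l) * (v - X) * ((q - l * p) * (u * p - q))"
    by (simp add: power2_eq_square algebra_simps)
  also have "\<dots> \<ge> 0"
    using assms by (intro add_nonneg_nonneg mult_nonneg_nonneg) auto
  finally show ?thesis
    using \<open>l < u\<close> by (simp add: zero_le_mult_iff)
qed

text \<open>
  The end point conditions are multiplied through by \<open>D\<close>, so that for integer lists they involve
  only integers besides \<open>v\<close>, \<open>l\<close> and \<open>u\<close>. The condition \<open>slope\<close> is \<open>X \<le> v\<close> for \<open>X = (D - r\<^sub>1) / D\<close>.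
\<close>

lemma P_coeff_sum_ge_between:
  assumes a: "a \<in> P n" and D: "D > 0"
    and corr: "\<And>k. 2 \<le> k \<Longrightarrow> k < length h \<Longrightarrow> autocorr h k \<le> D"
    and slope: "D - autocorr h 1 \<le> v * D" and "l < u"
    and l: "v * D * (l - 1)\<^sup>2 \<le> (D - autocorr h 1) * l\<^sup>2 - autocorr h 0"
    and u: "v * D * (u - 1)\<^sup>2 \<le> (D - autocorr h 1) * u\<^sup>2 - autocorr h 0"
    and between: "l * sqrt (a 0) \<le> sqrt (a 1)" "sqrt (a 1) \<le> u * sqrt (a 0)"
  shows "v * (sqrt (a 1) - sqrt (a 0))\<^sup>2 \<le> cos_poly n a 0 - a 0"
proof -
  have "a 0 \<ge> 0" "a 1 \<ge> 0" using a by (auto simp: P_def)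
  then have "v * D * (sqrt (a 1) - sqrt (a 0))\<^sup>2 \<le> (D - autocorr h 1) * a 1 - autocorr h 0 * a 0"
    using quadratic_ge_between[OF slope \<open>l < u\<close> _ between l u] by simp
  also have "\<dots> \<le> D * (cos_poly n a 0 - a 0)"
    using D by (intro P_coeff_sum_ge[OF a corr]) auto
  finally have "D * (v * (sqrt (a 1) - sqrt (a 0))\<^sup>2) \<le> D * (cos_poly n a 0 - a 0)"
    by (simp add: mult_ac)
  then show ?thesis using D by simp
qed

section \<open>Explicit multipliers and the lower bound\<close>

text \<open>
  The three lists are scaled by \<open>10\<^sup>5\<close>, hence \<open>D = 10\<^sup>1\<^sup>0\<close>. Each comes from maximising \<open>X = (D - r\<^sub>1) / D\<close> over
  nonnegative cosine polynomials of degree 30 (the first list) or 42 with constant term \<open>r\<^sub>0\<close>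
  and \<open>r\<^sub>k \<le> D\<close> for \<open>k \<ge> 2\<close>, where the line given by \<open>X\<close> and \<open>m = r\<^sub>0 / D\<close> is
  required to meet the curve \<open>v (x - 1)\<^sup>2\<close> near the left end of an interval;
  the largest slope then gives the longest interval. The numerical solution is
  factorised as a squared modulus and rounded, so that nonnegativity survives rounding exactly.
\<close>

definition dual_low :: "real list" where
  "dual_low =
   [26034, -90836, 156169, -153402, 70667, 14835, -24144, -24484, 46479, -11257, -22780, 6806,
   20958, 414, -50532, 51389, 12127, -60769, 32157, 29574, -38727, -10269, 41388, -9368,
   -41375, 46006, -4776, -30914, 31723, -14221, 2542]"

definition dual_mid :: "real list" where
  "dual_mid =
   [28134, -100823, 175478, -170906, 73972, 21402, -27658, -21469, 31118, 8877, -21075, -22273,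
   52834, -23650, -14403, 5291, 17374, 938, -30760, 10510, 33932, -21562, -42394, 61003, 1015,
   -56239, 29814, 29111, -35386, 596, 3781, 25810, -25320, -19822, 44850, -9142, -40493, 41692,
   -1065, -29730, 27747, -11759, 2067]"

definition dual_high :: "real list" where
  "dual_high =
   [33354, -123748, 210506, -186235, 52688, 50402, -32579, -25208, 15753, 27763, -19043,
   -19345, 12822, 18564, -8237, -20608, 4975, 24311, 57, -40155, 16038, 33547, -10559, -56456,
   51386, 23079, -46953, -9626, 46530, -17817, -3563, -21597, 29519, 14089, -42304, 7326,
   34795, -21591, -19423, 30119, -10575, -3552, 2721]"

lemma all_from_2_below: "list_all Q [2..<n] \<Longrightarrow> 2 \<le> k \<Longrightarrow> k < n \<Longrightarrow> Q k"
  by (simp add: list_all_iff)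

lemma autocorr_dual_low:
  "autocorr dual_low 0 = 86908732394" "autocorr dual_low 1 = -59825775769"
  "2 \<le> k \<Longrightarrow> k < length dual_low \<Longrightarrow> autocorr dual_low k \<le> 10 ^ 10"
proof -
  have "list_all (\<lambda>k. autocorr dual_low k \<le> 10 ^ 10) [2..<length dual_low]"
    by (simp add: dual_low_def autocorr_def)
  then show "2 \<le> k \<Longrightarrow> k < length dual_low \<Longrightarrow> autocorr dual_low k \<le> 10 ^ 10"
    by (rule all_from_2_below)
qed (simp_all add: dual_low_def autocorr_def)

lemma autocorr_dual_mid:
  "autocorr dual_mid 0 = 107319458305" "autocorr dual_mid 1 = -71850925783"
  "2 \<le> k \<Longrightarrow> k < length dual_mid \<Longrightarrow> autocorr dual_mid k \<le> 10 ^ 10"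
proof -
  have "list_all (\<lambda>k. autocorr dual_mid k \<le> 10 ^ 10) [2..<length dual_mid]"
    by (simp add: dual_mid_def autocorr_def)
  then show "2 \<le> k \<Longrightarrow> k < length dual_mid \<Longrightarrow> autocorr dual_mid k \<le> 10 ^ 10"
    by (rule all_from_2_below)
qed (simp_all add: dual_mid_def autocorr_def)

lemma autocorr_dual_high:
  "autocorr dual_high 0 = 126540801518" "autocorr dual_high 1 = -82881562676"
  "2 \<le> k \<Longrightarrow> k < length dual_high \<Longrightarrow> autocorr dual_high k \<le> 10 ^ 10"
proof -
  have "list_all (\<lambda>k. autocorr dual_high k \<le> 10 ^ 10) [2..<length dual_high]"
    by (simp add: dual_high_def autocorr_def)
  then show "2 \<le> k \<Longrightarrow> k < length dual_high \<Longrightarrow> autocorr dual_high k \<le> 10 ^ 10"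
    by (rule all_from_2_below)
qed (simp_all add: dual_high_def autocorr_def)

text \<open>
  The interval ends 1.2052, 1.3025 and 1.32 lie where the ranges of consecutive multipliers
  overlap. The infimum is nearly attained at \<open>\<surd>a\<^sub>1 / \<surd>a\<^sub>0 = 1.318\<close>, and it is around this value that
  the multipliers need the highest degree.
\<close>

lemma P_coeff_sum_lower_bound:
  assumes a: "a \<in> P n"
  shows "34.468306 * (sqrt (a 1) - sqrt (a 0))\<^sup>2 \<le> cos_poly n a 0 - a 0"
proof -
  let ?p = "sqrt (a 0)" and ?q = "sqrt (a 1)"
  have "a 0 \<ge> 0" "a 1 > a 0" using a by (auto simp: P_def)
  then have pq: "?p \<le> ?q" "?p \<ge> 0" by auto
  have "a 1 \<le> 1.4143\<^sup>2 * a 0"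
    using P_coeff_1_le[OF a] \<open>a 0 \<ge> 0\<close> by (simp add: power2_eq_square)
  then have "?q \<le> 1.4143 * ?p"
    using \<open>a 0 \<ge> 0\<close> by (intro real_le_lsqrt) (simp_all add: power_mult_distrib power_divide)
  then consider "?q \<le> 1.2052 * ?p" | "1.2052 * ?p \<le> ?q" "?q \<le> 1.3025 * ?p"
    | "1.3025 * ?p \<le> ?q" "?q \<le> 1.32 * ?p" | "1.32 * ?p \<le> ?q" "?q \<le> 1.4143 * ?p"
    by linarith
  then show ?thesis
  proof cases
    case 1
    \<comment> \<open>The empty multiplier expresses that the coefficient sum is at least \<open>a 1\<close>.\<close>
    show ?thesis
      by (rule P_coeff_sum_ge_between[OF a, where h = "[]" and D = 1 and l = 1 and u = "1.2052"])
         (use 1 pq in \<open>simp_all add: power2_eq_square\<close>)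
  next
    case 2
    show ?thesis
      by (rule P_coeff_sum_ge_between[OF a _ autocorr_dual_low(3) _ _ _ _ 2])
         (simp_all add: autocorr_dual_low power2_eq_square del: One_nat_def)
  next
    case 3
    show ?thesis
      by (rule P_coeff_sum_ge_between[OF a _ autocorr_dual_mid(3) _ _ _ _ 3])
         (simp_all add: autocorr_dual_mid power2_eq_square del: One_nat_def)
  next
    case 4
    show ?thesis
      by (rule P_coeff_sum_ge_between[OF a _ autocorr_dual_high(3) _ _ _ _ 4])
         (simp_all add: autocorr_dual_high power2_eq_square del: One_nat_def)
  qed
qed

lemma inf_ratio_ge: "ereal 34.468306 \<le> inf_ratio n"
  unfolding inf_ratio_def
proof (rule INF_greatest)
  fix a assume a: "a \<in> P n"
  then have "sqrt (a 1) - sqrt (a 0) > 0" by (simp add: P_def)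
  then show "ereal 34.468306 \<le> ereal (ratio n a)"
    using P_coeff_sum_lower_bound[OF a] by (simp add: ratio_def pos_le_divide_eq)
qed

section \<open>A near-optimal polynomial\<close>

text \<open>
  A rounded spectral factor, scaled by \<open>10\<^sup>6\<close>, of a numerically optimal polynomial of degree 40.
  The optimum has zeros on the unit circle and several vanishing coefficients; the polynomial that is
  factorised was kept away from both constraints by \<open>2 \<cdot> 10\<^sup>-\<^sup>6\<close>
  (in units where \<open>\<surd>a\<^sub>1 - \<surd>a\<^sub>0\<close> is about 1), so that rounding makes no coefficient negative.
\<close>

definition near_optimal :: "real list" where
  "near_optimal =
   [114760, 540246, 1267637, 1868911, 1808595, 1054611, 192660, -190523, -92848, 71830, 57577,
   -26111, -28051, 16452, 16640, -11637, -10259, 9177, 7202, -6701, -4340, 5372, 2870, -4110,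
   -1391, 3363, 464, -2553, 321, 1956, -923, -1190, 1161, 522, -1121, 257, 596, -568, 224, -32,
   9]"

lemma autocorr_near_optimal:
  "autocorr near_optimal 0 = 9881040550385"
  "2 * autocorr near_optimal 1 = 17167864983756"
  "(sum_list near_optimal)\<^sup>2 - autocorr near_optimal 0 = 34488613162640"
  "list_all (\<lambda>k. 0 \<le> autocorr near_optimal k) [2..<length near_optimal]"
  by (simp_all add: near_optimal_def autocorr_def)

lemma square_coeffs_near_optimal_in_P: "square_coeffs near_optimal \<in> P 40"
proof -
  have len: "length near_optimal = 41"
    by (simp add: near_optimal_def)
  have "square_coeffs near_optimal k \<ge> 0" for k
  proof -
    consider "k = 0" | "k = 1" | "2 \<le> k" "k < length near_optimal" | "length near_optimal \<le> k"
      by linarith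
    then show ?thesis
    proof cases
      case 3
      then show ?thesis
        using all_from_2_below[OF autocorr_near_optimal(4) 3] by (simp add: square_coeffs_def)
    qed (use autocorr_near_optimal in \<open>auto simp: square_coeffs_def autocorr_beyond\<close>)
  qed
  then show ?thesis
    using autocorr_near_optimal
    by (auto simp: P_def len square_coeffs_def autocorr_beyond cos_poly_square_coeffs_nonneg)
qed

text \<open>
  The scaling makes \<open>\<surd>a\<^sub>1 - \<surd>a\<^sub>0\<close> almost equal to \<open>10\<^sup>6\<close>, and rounding the two roots to integers in the
  unfavourable direction costs less than \<open>10\<^sup>-\<^sup>4\<close> in the ratio.
\<close>

lemma ratio_near_optimal: "ratio 40 (square_coeffs near_optimal) < 34.4889"
proof -
  let ?a = "square_coeffs near_optimal"
  have a: "?a 0 = 9881040550385" "?a 1 = 17167864983756"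
    using autocorr_near_optimal by (simp_all add: square_coeffs_def)
  have "sqrt (?a 0) \<le> 3143413" "4143412 \<le> sqrt (?a 1)"
    unfolding a by (rule real_le_lsqrt, simp, simp) (rule real_le_rsqrt, simp)
  then have "999999\<^sup>2 \<le> (sqrt (?a 1) - sqrt (?a 0))\<^sup>2"
    by (intro power_mono) auto
  moreover have "cos_poly 40 ?a 0 - ?a 0 = 34488613162640"
    using autocorr_near_optimal(3)
    by (simp add: cos_poly_square_coeffs_0 near_optimal_def square_coeffs_def)
  ultimately show ?thesis
    by (simp add: ratio_def divide_less_eq power2_eq_square)
qed

theorem theorem2:
  shows "ereal 34.468305 < V \<and> V < ereal 34.4889920009"
proof
  \<comment> \<open>A uniform bound passes to the limit only as a weak inequality, hence the last digit to spare.\<close>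
  have "ereal 34.468306 \<le> V"
    using inf_ratio_tendsto_V by (rule LIMSEQ_le_const) (use inf_ratio_ge in blast)
  then show "ereal 34.468305 < V"
    by (rule less_le_trans[rotated]) simp
  have "V \<le> inf_ratio 40"
    by (rule decseq_ge[OF decseq_inf_ratio inf_ratio_tendsto_V])
  also have "\<dots> \<le> ereal (ratio 40 (square_coeffs near_optimal))"
    unfolding inf_ratio_def by (rule INF_lower[OF square_coeffs_near_optimal_in_P])
  also have "\<dots> < ereal 34.4889920009"
    using ratio_near_optimal by simp
  finally show "V < ereal 34.4889920009" .
qed

end
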